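(* Let $f,g:\mathbb{R}\to\mathbb{R}$ be continuous odd functions such that $xf(x)>0$ and $xg(x)>0$ for all $x\in\mathbb{R}\setminus\{0\}$, and $f(0)=g(0)=0$. Suppose that the limits $$a=\lim_{x\to0}\frac{f(x)}{x},\quad A=\lim_{x\to\infty}\frac{f(x)}{x},\quad b=\lim_{y\to0}\frac{g(y)}{y},\quad B=\lim_{y\to\infty}\frac{g(y)}{y}$$ exist in $[0,\infty]$ (the values $0$ and $\infty$ being allowed), and that $$\lim_{x\to\infty}\int_0^x f(\xi)\,d\xi=\infty,\qquad \lim_{x\to\infty}\int_0^x g(\xi)\,d\xi=\infty.$$ If the products $ab$ and $AB$ are defined in $[0,\infty]$ (i.e. neither is of the form $0\cdot\infty$) and either $$ab<\frac{\pi^2}{2}<AB\qquad\text{or}\qquad AB<\frac{\pi^2}{2}<ab,$$ then the system $$x'(t)=-g(y(t)),\qquad y'(t)=2f(x(t))$$ has a closed orbit with minimal period $2$, and thus the distributed delay differential equation $$x'(t)=-g\left(\int_0^1 f(x(t-s))\,ds\right)$$ has a special symmetric periodic solution (SSPS).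
   Context: A special symmetric periodic solution (SSPS) of the delay equation $x'(t)=-g\left(\int_0^1 f(x(t-s))ds\right)$ is a differentiable function $x:\mathbb{R}\to\mathbb{R}$ satisfying the equation for all $t\in\mathbb{R}$ that is periodic with minimal period $2$ and satisfies $x(t)+x(t-1)=0$ for all $t\in\mathbb{R}$. A closed orbit with minimal period $2$ of the planar system is the trajectory of a (nonconstant) periodic solution with minimal period $2$. *)

theory Defs
  imports "HOL-Analysis.Analysis" "HOL-Library.Periodic_Fun" "HOL-Library.Extended_Real"
begin

text \<open>A constant function has no minimal period in this sense, so having one entails
  being nonconstant.\<close>

definition has_minimal_period :: "(real \<Rightarrow> 'a) \<Rightarrow> real \<Rightarrow> bool" where
  "has_minimal_period u T \<longleftrightarrow>
     0 < T \<and> periodic_fun_simple u T \<and> (\<forall>S. 0 < S \<and> S < T \<longrightarrow> \<not> periodic_fun_simple u S)"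

definition planar_solution ::
    "(real \<Rightarrow> real) \<Rightarrow> (real \<Rightarrow> real) \<Rightarrow> (real \<Rightarrow> real) \<Rightarrow> (real \<Rightarrow> real) \<Rightarrow> bool" where
  "planar_solution f g x y \<longleftrightarrow>
     (\<forall>t. (x has_real_derivative - g (y t)) (at t) \<and>
          (y has_real_derivative 2 * f (x t)) (at t))"

definition closed_orbit ::
    "(real \<Rightarrow> real) \<Rightarrow> (real \<Rightarrow> real) \<Rightarrow> real \<Rightarrow> (real \<times> real) set \<Rightarrow> bool" where
  "closed_orbit f g T \<Gamma> \<longleftrightarrow>
     (\<exists>x y. planar_solution f g x y \<and> has_minimal_period (\<lambda>t. (x t, y t)) T \<and>
            \<Gamma> = range (\<lambda>t. (x t, y t)))"

text \<open>For continuous \<open>f\<close> the integrand below is continuous, because \<open>x\<close> is differentiable;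
  so the Henstock-Kurzweil integral is the ordinary Riemann integral.\<close>

definition SSPS :: "(real \<Rightarrow> real) \<Rightarrow> (real \<Rightarrow> real) \<Rightarrow> (real \<Rightarrow> real) \<Rightarrow> bool" where
  "SSPS f g x \<longleftrightarrow>
     (\<forall>t. (x has_real_derivative - g (integral {0..1} (\<lambda>s. f (x (t - s))))) (at t)) \<and>
     has_minimal_period x 2 \<and>
     (\<forall>t. x t + x (t - 1) = 0)"

end

theory Submission
  imports Defs
begin

text \<open>Put \<open>p = 2 f\<close>, \<open>q = g\<close>, with even primitives \<open>P\<close>, \<open>Q\<close> vanishing at \<open>0\<close>. The planar system
\<open>x' = - q(y)\<close>, \<open>y' = p(x)\<close> conserves the energy \<open>P(x) + Q(y)\<close>. In polar coordinates the energy
increases strictly along each ray, from \<open>0\<close> to \<open>\<infinity>\<close>, so every level \<open>h > 0\<close> is a curve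
\<open>\<rho> = radius h \<theta>\<close> around the origin, and a solution on it turns with angular velocity
\<open>(x p(x) + y q(y)) / \<rho>\<^sup>2 > 0\<close>. Hence elapsed time is an
increasing \<open>C\<^sup>1\<close> function of the angle, and its inverse yields a solution for all times, although
\<open>f\<close> and \<open>g\<close> are merely continuous (\<open>quasiperiodic_time_change\<close>, \<open>symmetric_solution\<close>).
As the picture is symmetric under \<open>\<theta> \<mapsto> \<theta> + \<pi>\<close>, the time
\<open>half_period h\<close> taken by half a turn is half of the minimal period, and the solution changes sign
after it. It remains to find a level with \<open>half_period h = 1\<close>.

The half period depends continuously on \<open>h\<close> because the radius does, by the inverse function
theorem. If \<open>x p(x) + y q(y) \<le> \<alpha> x\<^sup>2 + \<beta> y\<^sup>2\<close> on a level, the motion there turns no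
faster than that of the linear system \<open>x' = - \<beta> y\<close>, \<open>y' = \<alpha> x\<close>, whose half period is
\<open>\<pi> / sqrt (\<alpha> \<beta>)\<close>; likewise for \<open>\<ge>\<close> (\<open>half_period_ge\<close>, \<open>half_period_le\<close>). The limits
of \<open>f(x) / x\<close> and \<open>g(y) / y\<close> provide such bounds on very small and on very large levels, with
\<open>\<alpha> \<beta>\<close> on the desired side of \<open>\<pi>\<^sup>2\<close>. So the half period is at least \<open>1\<close> at one end
and at most \<open>1\<close> at the other (\<open>slow_level\<close>, \<open>fast_level\<close>), and the intermediate value theorem
applies.

Finally, \<open>x(t - 1) = - x(t)\<close> and \<open>y(t - 1) = - y(t)\<close> turn the second equation, integrated over
\<open>[t - 1, t]\<close>, into \<open>2 y(t) = 2 \<integral>\<^sub>0\<^sup>1 f(x(t - s)) ds\<close>, so that the first equation becomes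
the delay equation.\<close>

section \<open>Primitives and a change of time\<close>

lemma continuous_has_antiderivative:
  fixes f :: "real \<Rightarrow> real"
  assumes "continuous_on UNIV f"
  obtains F where "\<And>x. (F has_real_derivative f x) (at x)" "F 0 = 0"
proof -
  have "\<exists>F. \<forall>x::real. (-\<infinity>::ereal) < x \<longrightarrow> x < (\<infinity>::ereal) \<longrightarrow> (F has_vector_derivative f x) (at x)"
    by (rule einterval_antiderivative) (use assms in \<open>auto simp: continuous_on_eq_continuous_at\<close>)
  then obtain F where F: "\<And>x. (F has_real_derivative f x) (at x)"
    by (auto simp: has_real_derivative_iff_has_vector_derivative)
  show thesis
    by (rule that[of "\<lambda>x. F x - F 0"]) (auto intro!: derivative_eq_intros F)
qed

lemma integral_eq_antiderivative_diff:
  fixes F f :: "real \<Rightarrow> real"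
  assumes "\<And>x. (F has_real_derivative f x) (at x)" "a \<le> b"
  shows "integral {a..b} f = F b - F a"
  by (rule integral_unique, rule fundamental_theorem_of_calculus)
     (use assms in \<open>auto simp: has_real_derivative_iff_has_vector_derivative
        intro: has_vector_derivative_at_within\<close>)

text \<open>With \<open>w\<close> the time spent per unit angle, its primitive \<open>\<tau>\<close> is the time at which an angle is
reached, and \<open>\<Theta>\<close> is the inverse of \<open>\<tau>\<close>. Periodicity of \<open>w\<close> gives
\<open>\<tau>(\<theta> + L) = \<tau>(\<theta>) + \<integral>\<^sub>0\<^sup>L w\<close>, which makes \<open>\<tau>\<close> unbounded in both directions, hence
onto.\<close>
lemma quasiperiodic_time_change:
  fixes w :: "real \<Rightarrow> real"
  assumes cont: "continuous_on UNIV w" and pos: "\<And>\<theta>. w \<theta> > 0"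
    and per: "\<And>\<theta>. w (\<theta> + L) = w \<theta>" and L: "L > 0"
  obtains \<Theta> where "\<Theta> 0 = 0" "\<And>t. (\<Theta> has_real_derivative 1 / w (\<Theta> t)) (at t)"
    "\<And>t. \<Theta> (t + integral {0..L} w) = \<Theta> t + L"
proof -
  define T where "T = integral {0..L} w"
  obtain \<tau> where d\<tau>: "\<And>\<theta>. (\<tau> has_real_derivative w \<theta>) (at \<theta>)" and \<tau>0: "\<tau> 0 = 0"
    using continuous_has_antiderivative[OF cont] by metis
  have T: "T = \<tau> L"
    using integral_eq_antiderivative_diff[OF d\<tau>, of 0 L] L \<tau>0 by (simp add: T_def)
  have mono: "\<tau> \<theta> < \<tau> \<theta>'" if "\<theta> < \<theta>'" for \<theta> \<theta>'
    by (rule DERIV_pos_imp_increasing[OF that]) (use d\<tau> pos in blast)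
  have Tpos: "T > 0"
    using mono[OF L] T \<tau>0 by simp
  have shift: "\<tau> (\<theta> + L) = \<tau> \<theta> + T" for \<theta>
  proof -
    have "((\<lambda>\<theta>. \<tau> (\<theta> + L) - \<tau> \<theta>) has_real_derivative 0) (at \<theta>)" for \<theta>
      by (rule derivative_eq_intros d\<tau>[THEN DERIV_chain2] refl)+ (simp add: per)
    then have "\<tau> (\<theta> + L) - \<tau> \<theta> = \<tau> (0 + L) - \<tau> 0"
      using DERIV_isconst_all[of "\<lambda>\<theta>. \<tau> (\<theta> + L) - \<tau> \<theta>"] by blast
    then show ?thesis
      using T \<tau>0 by simp
  qed
  have mult: "\<tau> (real n * L) = real n * T \<and> \<tau> (- (real n * L)) = - (real n * T)" for n
  proof (induction n)
    case (Suc n)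
    have "\<tau> (real (Suc n) * L) = \<tau> (real n * L) + T"
      using shift[of "real n * L"] by (simp add: algebra_simps)
    moreover have "\<tau> (- (real (Suc n) * L)) = \<tau> (- (real n * L)) - T"
      using shift[of "- (real (Suc n) * L)"] by (simp add: algebra_simps)
    ultimately show ?case
      using Suc by (simp add: algebra_simps)
  qed (use \<tau>0 in simp)
  have cont\<tau>: "continuous_on UNIV \<tau>"
    using DERIV_isCont[OF d\<tau>] by (simp add: continuous_at_imp_continuous_on)
  have surj: "\<exists>\<theta>. \<tau> \<theta> = t" for t
  proof -
    obtain n :: nat where n: "\<bar>t\<bar> / T \<le> real n"
      using real_arch_simple by blast
    then have "\<bar>t\<bar> \<le> real n * T"
      using Tpos by (simp add: field_simps)
    then have "\<exists>\<theta>. - (real n * L) \<le> \<theta> \<and> \<theta> \<le> real n * L \<and> \<tau> \<theta> = t"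
      by (intro IVT') (use mult[of n] L in \<open>auto intro: continuous_on_subset[OF cont\<tau>]\<close>)
    then show ?thesis by blast
  qed
  have inj: "inj \<tau>"
    by (rule linorder_injI) (use mono in \<open>metis less_irrefl\<close>)
  define \<Theta> where "\<Theta> = inv \<tau>"
  have \<Theta>\<tau>: "\<Theta> (\<tau> \<theta>) = \<theta>" for \<theta>
    by (simp add: \<Theta>_def inj)
  have \<tau>\<Theta>: "\<tau> (\<Theta> t) = t" for t
    unfolding \<Theta>_def by (rule f_inv_into_f) (use surj in \<open>metis rangeI\<close>)
  show thesis
  proof (rule that[of \<Theta>])
    show "\<Theta> 0 = 0"
      using \<Theta>\<tau>[of 0] \<tau>0 by simp
    show "(\<Theta> has_real_derivative 1 / w (\<Theta> t)) (at t)" for t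
    proof -
      have "(\<Theta> has_derivative (\<lambda>s. 1 / w (\<Theta> t) * s)) (at (\<tau> (\<Theta> t)))"
      proof (rule has_derivative_inverse_strong[where f = \<tau> and S = UNIV and f' = "\<lambda>s. w (\<Theta> t) * s"])
        show "(\<tau> has_derivative (*) (w (\<Theta> t))) (at (\<Theta> t))"
          using d\<tau>[of "\<Theta> t"] by (simp add: has_field_derivative_def)
      qed (use cont\<tau> \<Theta>\<tau> pos[of "\<Theta> t"] in auto)
      then show ?thesis
        by (simp only: has_field_derivative_def \<tau>\<Theta>)
    qed
    show "\<Theta> (t + integral {0..L} w) = \<Theta> t + L" for t
      using \<Theta>\<tau>[of "\<Theta> t + L"] by (simp add: shift \<tau>\<Theta> T_def)
  qed
qed

section \<open>The half period of the linear oscillator\<close>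

text \<open>The textbook primitive \<open>arctan (n tan \<theta> / m) / (m n)\<close>, with \<open>m = sqrt \<alpha>\<close> and
\<open>n = sqrt \<beta>\<close>, breaks down at \<open>\<pi> / 2\<close>. The angle between
\<open>(m cos \<theta>, n sin \<theta>)\<close> and \<open>(cos \<theta>, sin \<theta>)\<close> is however always acute, so it is
\<open>arctan (N / D)\<close> with their cross product \<open>N\<close> and inner product \<open>D > 0\<close>; adding
\<open>\<theta>\<close> to it gives a primitive that is smooth everywhere.\<close>
lemma ellipse_angle_integral:
  fixes \<alpha> \<beta> :: real
  assumes "\<alpha> > 0" "\<beta> > 0"
  shows "((\<lambda>\<theta>. 1 / (\<alpha> * (cos \<theta>)\<^sup>2 + \<beta> * (sin \<theta>)\<^sup>2)) has_integral pi / sqrt (\<alpha> * \<beta>)) {0..pi}"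
proof -
  define m n where "m = sqrt \<alpha>" and "n = sqrt \<beta>"
  have mn: "m > 0" "n > 0" "\<alpha> = m\<^sup>2" "\<beta> = n\<^sup>2"
    using assms by (auto simp: m_def n_def)
  define N where "N \<theta> = (n - m) * (sin \<theta> * cos \<theta>)" for \<theta>
  define D where "D \<theta> = m * (cos \<theta>)\<^sup>2 + n * (sin \<theta>)\<^sup>2" for \<theta>
  define \<Phi> where "\<Phi> \<theta> = (\<theta> + arctan (N \<theta> / D \<theta>)) / (m * n)" for \<theta>
  have pos: "u * (cos \<theta>)\<^sup>2 + v * (sin \<theta>)\<^sup>2 > 0" if "u > 0" "v > 0" for u v \<theta> :: real
  proof (cases "sin \<theta> = 0")
    case True
    then have "(cos \<theta>)\<^sup>2 = 1" by (simp add: cos_squared_eq)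
    then show ?thesis using True that by simp
  qed (use that in \<open>simp add: add_nonneg_pos\<close>)
  have "(\<Phi> has_real_derivative 1 / (m\<^sup>2 * (cos \<theta>)\<^sup>2 + n\<^sup>2 * (sin \<theta>)\<^sup>2)) (at \<theta>)" for \<theta>
  proof -
    define N' where "N' = (n - m) * ((cos \<theta>)\<^sup>2 - (sin \<theta>)\<^sup>2)"
    define D' where "D' = 2 * (n - m) * (sin \<theta> * cos \<theta>)"
    define E where "E = m\<^sup>2 * (cos \<theta>)\<^sup>2 + n\<^sup>2 * (sin \<theta>)\<^sup>2"
    have D0: "D \<theta> > 0" and E0: "E > 0"
      unfolding D_def E_def using pos mn by auto
    have circle: "(sin \<theta>)\<^sup>2 + (cos \<theta>)\<^sup>2 = 1" by simp
    (* N^2 + D^2 is the squared norm of (m cos, n sin), as the other vector is a unit vector. *)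
    have norm: "(D \<theta>)\<^sup>2 + (N \<theta>)\<^sup>2 = E"
      using circle unfolding D_def N_def E_def by algebra
    have wronskian: "N' * D \<theta> - N \<theta> * D' + E = m * n"
      using circle unfolding D_def N_def D'_def N'_def E_def by algebra
    have dN: "(N has_real_derivative N') (at \<theta>)"
      unfolding N_def N'_def by (auto intro!: derivative_eq_intros simp: power2_eq_square)
    have dD: "(D has_real_derivative D') (at \<theta>)"
      unfolding D_def D'_def by (auto intro!: derivative_eq_intros simp: algebra_simps)
    have "(\<Phi> has_real_derivative
        (1 + inverse (1 + (N \<theta> / D \<theta>)\<^sup>2) * ((N' * D \<theta> - N \<theta> * D') / (D \<theta> * D \<theta>))) / (m * n)) (at \<theta>)"
      unfolding \<Phi>_def using D0 mn
      by (intro DERIV_cdivide DERIV_add DERIV_ident DERIV_chain2[OF DERIV_arctan] DERIV_divide dN dD) auto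
    moreover have "(1 + inverse (1 + (N \<theta> / D \<theta>)\<^sup>2) * ((N' * D \<theta> - N \<theta> * D') / (D \<theta> * D \<theta>))) / (m * n) = 1 / E"
    proof -
      have "1 + (N \<theta> / D \<theta>)\<^sup>2 = E / (D \<theta> * D \<theta>)"
        using D0 by (simp add: norm[symmetric] power2_eq_square field_simps)
      then have "1 + inverse (1 + (N \<theta> / D \<theta>)\<^sup>2) * ((N' * D \<theta> - N \<theta> * D') / (D \<theta> * D \<theta>))
          = (N' * D \<theta> - N \<theta> * D' + E) / E"
        using D0 E0 by (simp add: add_divide_distrib)
      also have "\<dots> / (m * n) = 1 / E"
        using mn by (simp add: wronskian)
      finally show ?thesis .
    qed
    ultimately show ?thesis
      by (simp add: E_def)
  qed
  then have "((\<lambda>\<theta>. 1 / (m\<^sup>2 * (cos \<theta>)\<^sup>2 + n\<^sup>2 * (sin \<theta>)\<^sup>2)) has_integral \<Phi> pi - \<Phi> 0) {0..pi}"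
    by (intro fundamental_theorem_of_calculus)
       (auto simp: has_real_derivative_iff_has_vector_derivative intro: has_vector_derivative_at_within)
  moreover have "\<Phi> pi - \<Phi> 0 = pi / sqrt (\<alpha> * \<beta>)"
    by (simp add: \<Phi>_def N_def m_def n_def real_sqrt_mult)
  ultimately show ?thesis
    by (simp add: mn)
qed

section \<open>Bounds extracted from limits of quotients\<close>

text \<open>The gap between \<open>\<alpha>\<close> and the limit is kept as a quadratic surplus \<open>\<epsilon> x\<^sup>2\<close>. Far out, this
surplus absorbs the bounded error that the other coordinate causes while it is small
(see \<open>defect_nonneg_near_infinity\<close>).\<close>
lemma eventually_defect:
  fixes u :: "real \<Rightarrow> real"
  assumes F: "F = at 0 \<or> F = at_top"
    and lim: "((\<lambda>x. ereal (u x / x)) \<longlongrightarrow> l) F"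
  shows "l < ereal \<alpha> \<Longrightarrow> \<exists>\<epsilon>>0. \<forall>\<^sub>F x in F. \<epsilon> * x\<^sup>2 \<le> \<alpha> * x\<^sup>2 - x * u x"
    and "ereal \<alpha> < l \<Longrightarrow> \<exists>\<epsilon>>0. \<forall>\<^sub>F x in F. \<epsilon> * x\<^sup>2 \<le> x * u x - \<alpha> * x\<^sup>2"
proof -
  have nz: "\<forall>\<^sub>F x in F. x \<noteq> 0"
    using F eventually_neq_at_within[of 0 0 UNIV] eventually_gt_at_top[of "0::real"]
    by (auto elim: eventually_mono)
  {
    assume "l < ereal \<alpha>"
    then obtain s where s: "l < ereal s" "s < \<alpha>"
      using ereal_dense2[of l "ereal \<alpha>"] by auto
    have "\<forall>\<^sub>F x in F. (\<alpha> - s) * x\<^sup>2 \<le> \<alpha> * x\<^sup>2 - x * u x"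
      using order_tendstoD(2)[OF lim s(1)] nz
    proof eventually_elim
      case (elim x)
      then have "x * u x \<le> s * x\<^sup>2"
        using mult_right_mono[of "u x / x" s "x\<^sup>2"] by (simp add: power2_eq_square mult.commute)
      then show ?case by (simp add: algebra_simps)
    qed
    then show "\<exists>\<epsilon>>0. \<forall>\<^sub>F x in F. \<epsilon> * x\<^sup>2 \<le> \<alpha> * x\<^sup>2 - x * u x"
      using s(2) by (intro exI[of _ "\<alpha> - s"]) simp
  next
    assume "ereal \<alpha> < l"
    then obtain s where s: "ereal s < l" "\<alpha> < s"
      using ereal_dense2[of "ereal \<alpha>" l] by auto
    have "\<forall>\<^sub>F x in F. (s - \<alpha>) * x\<^sup>2 \<le> x * u x - \<alpha> * x\<^sup>2"
      using order_tendstoD(1)[OF lim s(1)] nz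
    proof eventually_elim
      case (elim x)
      then have "s * x\<^sup>2 \<le> x * u x"
        using mult_right_mono[of s "u x / x" "x\<^sup>2"] by (simp add: power2_eq_square mult.commute)
      then show ?case by (simp add: algebra_simps)
    qed
    then show "\<exists>\<epsilon>>0. \<forall>\<^sub>F x in F. \<epsilon> * x\<^sup>2 \<le> x * u x - \<alpha> * x\<^sup>2"
      using s(2) by (intro exI[of _ "s - \<alpha>"]) simp
  }
qed

text \<open>When the product is defined, a finite product forces both factors to be finite, and the slack in the
product leaves room to increase both of them a little. For \<open>0 \<cdot> \<infinity>\<close> the convention
\<open>0 * \<infinity> = 0\<close> would make the assertion false.\<close>
lemma ereal_mult_less_imp_real_bounds:
  fixes a b :: ereal
  assumes "0 \<le> a" "0 \<le> b" "a * b < ereal c"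
    and "\<not> (a = 0 \<and> b = \<infinity>)" "\<not> (a = \<infinity> \<and> b = 0)"
  obtains \<alpha> \<beta> :: real where "\<alpha> > 0" "\<beta> > 0" "a < ereal \<alpha>" "b < ereal \<beta>" "\<alpha> * \<beta> < c"
proof -
  have "a \<noteq> \<infinity>" "b \<noteq> \<infinity>"
    using assms by (auto simp: ereal_mult_infty ereal_infty_mult split: if_splits)
  then obtain r s where rs: "a = ereal r" "b = ereal s"
    using assms by (cases a; cases b) auto
  then have nonneg: "r \<ge> 0" "s \<ge> 0" and less: "r * s < c"
    using assms by auto
  define \<epsilon> where "\<epsilon> = min 1 ((c - r * s) / (2 * (r + s + 1)))"
  have \<epsilon>: "\<epsilon> > 0" "\<epsilon> \<le> 1"
    using nonneg less by (auto simp: \<epsilon>_def)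
  have "\<epsilon> * (r + s + 1) \<le> (c - r * s) / (2 * (r + s + 1)) * (r + s + 1)"
    using nonneg by (intro mult_right_mono) (auto simp: \<epsilon>_def)
  also have "\<dots> = (c - r * s) / 2"
    using nonneg by (simp add: field_simps)
  also have "\<dots> < c - r * s"
    using less by simp
  finally have "r * s + \<epsilon> * (r + s + 1) < c" by simp
  moreover have "\<epsilon> * \<epsilon> \<le> \<epsilon> * 1"
    using \<epsilon> by (intro mult_left_mono) auto
  ultimately have "(r + \<epsilon>) * (s + \<epsilon>) < c"
    by (simp add: algebra_simps)
  then show thesis
    using that[of "r + \<epsilon>" "s + \<epsilon>"] nonneg \<epsilon> rs by auto
qed

lemma ereal_less_mult_imp_real_bounds:
  fixes a b :: ereal
  assumes "0 \<le> a" "0 \<le> b" "ereal c < a * b" "c > 0"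
  obtains \<alpha> \<beta> :: real where "\<alpha> > 0" "\<beta> > 0" "ereal \<alpha> < a" "ereal \<beta> < b" "c < \<alpha> * \<beta>"
proof -
  have pos: "0 < a" "0 < b"
    using assms by (auto simp: less_le)
  obtain \<alpha> where \<alpha>: "\<alpha> > 0" "ereal \<alpha> < a" "ereal (c / \<alpha>) < b"
  proof (cases b)
    case (real s)
    then have s: "s > 0" using pos by simp
    have "ereal (c / s) < a"
      using assms(3) s real by (cases a) (auto simp: field_simps)
    then obtain \<alpha> where "ereal (c / s) < ereal \<alpha>" "ereal \<alpha> < a"
      using ereal_dense2 by blast
    moreover from this have "\<alpha> > 0"
      using \<open>c > 0\<close> s by (auto intro: less_trans[of 0 "c / s"])
    ultimately show thesis
      using that[of \<alpha>] s real by (simp add: field_simps)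
  next
    case PInf
    then show thesis
      using ereal_dense2[OF pos(1)] that by auto
  qed (use pos in simp)
  obtain \<beta> where \<beta>: "ereal (c / \<alpha>) < ereal \<beta>" "ereal \<beta> < b"
    using ereal_dense2[OF \<alpha>(3)] by blast
  then have "\<beta> > 0" "c < \<alpha> * \<beta>"
    using \<alpha>(1) \<open>c > 0\<close> by (auto simp: field_simps intro: less_trans[of 0 "c / \<alpha>"])
  then show thesis
    using that[of \<alpha> \<beta>] \<alpha> \<beta> by auto
qed

section \<open>Confining even potentials\<close>

locale confining_potential =
  fixes p P :: "real \<Rightarrow> real"
  assumes deriv: "\<And>x. (P has_real_derivative p x) (at x)"
    and cont: "continuous_on UNIV p"
    and odd: "\<And>x. p (- x) = - p x"
    and sign: "\<And>x. x \<noteq> 0 \<Longrightarrow> x * p x > 0"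
    and zero: "P 0 = 0"
    and unbounded: "filterlim P at_top at_top"
begin

lemma even: "P (- x) = P x"
proof -
  have "((\<lambda>x. P (- x) - P x) has_real_derivative 0) (at x)" for x
    by (rule derivative_eq_intros deriv[THEN DERIV_chain2] refl)+ (simp add: odd)
  then have "P (- x) - P x = P (- 0) - P 0"
    using DERIV_isconst_all[of "\<lambda>x. P (- x) - P x"] by blast
  then show ?thesis by simp
qed

lemma abs_arg: "P \<bar>x\<bar> = P x"
  by (simp add: abs_if even)

lemma virial_nonneg: "0 \<le> x * p x"
  using sign[of x] by (cases "x = 0") auto

lemma mono: "\<bar>x\<bar> \<le> \<bar>y\<bar> \<Longrightarrow> P x \<le> P y"
proof -
  assume "\<bar>x\<bar> \<le> \<bar>y\<bar>"
  then have "P \<bar>x\<bar> \<le> P \<bar>y\<bar>"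
  proof (rule DERIV_nonneg_imp_nondecreasing[where f = P])
    fix z assume "\<bar>x\<bar> \<le> z"
    then have "0 \<le> p z"
      using sign[of z] odd[of 0] by (cases "z = 0") (auto simp: zero_less_mult_iff)
    then show "\<exists>d. (P has_real_derivative d) (at z) \<and> 0 \<le> d"
      using deriv by blast
  qed
  then show ?thesis by (simp add: abs_arg)
qed

lemma nonneg: "0 \<le> P x"
  using mono[of 0 x] zero by simp

lemma pos: "x \<noteq> 0 \<Longrightarrow> 0 < P x"
proof -
  assume x: "x \<noteq> 0"
  have "P 0 < P \<bar>x\<bar>"
  proof (rule DERIV_pos_imp_increasing_open[where f = P])
    fix z :: real assume "0 < z"
    then have "0 < p z"
      using sign[of z] by (simp add: zero_less_mult_iff)
    then show "\<exists>d. (P has_real_derivative d) (at z) \<and> 0 < d"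
      using deriv by blast
  qed (use x in \<open>auto intro!: continuous_at_imp_continuous_on DERIV_isCont[OF deriv]\<close>)
  then show ?thesis by (simp add: abs_arg zero)
qed

lemma exceeds: obtains N where "N > 0" "P N \<ge> h"
proof -
  have "eventually (\<lambda>x. P x \<ge> h \<and> x > 0) at_top"
    using unbounded by (auto intro: eventually_conj eventually_gt_at_top simp: filterlim_at_top)
  then show thesis
    using that eventually_happens[of "\<lambda>x. P x \<ge> h \<and> x > 0" at_top] by auto
qed

end

section \<open>Energy levels in polar coordinates\<close>

lemma abs_cos_or_sin_ge_half: "1 / 2 \<le> \<bar>cos \<theta>\<bar> \<or> 1 / 2 \<le> \<bar>sin \<theta>\<bar>" for \<theta> :: real
proof (rule ccontr)
  assume "\<not> ?thesis"
  then have "\<bar>cos \<theta>\<bar>\<^sup>2 < (1/2)\<^sup>2" "\<bar>sin \<theta>\<bar>\<^sup>2 < (1/2)\<^sup>2"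
    by (intro power_strict_mono; simp)+
  then have "(sin \<theta>)\<^sup>2 + (cos \<theta>)\<^sup>2 < 1"
    by (simp add: power2_eq_square)
  then show False by simp
qed

text \<open>The system \<open>x' = - q(y)\<close>, \<open>y' = p(x)\<close> with conserved energy \<open>P(x) + Q(y)\<close>.\<close>
locale oscillator = pot_p: confining_potential p P + pot_q: confining_potential q Q
  for p P q Q
begin

definition energy :: "real \<Rightarrow> real \<Rightarrow> real" where
  "energy \<rho> \<theta> = P (\<rho> * cos \<theta>) + Q (\<rho> * sin \<theta>)"

text \<open>The quantity \<open>x p(x) + y q(y)\<close>. It is \<open>\<rho>\<close> times the radial derivative of the energy, and also
\<open>\<rho>\<^sup>2\<close> times the angular velocity of the motion: its positivity is what makes
levels star-shaped and the motion turn steadily.\<close>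
definition virial :: "real \<Rightarrow> real \<Rightarrow> real" where
  "virial \<rho> \<theta> = \<rho> * cos \<theta> * p (\<rho> * cos \<theta>) + \<rho> * sin \<theta> * q (\<rho> * sin \<theta>)"

lemma virial_pos: "\<rho> > 0 \<Longrightarrow> virial \<rho> \<theta> > 0"
proof -
  assume \<rho>: "\<rho> > 0"
  have "cos \<theta> \<noteq> 0 \<or> sin \<theta> \<noteq> 0"
    using sin_cos_squared_add[of \<theta>] by (auto simp del: sin_cos_squared_add)
  then have "\<rho> * cos \<theta> \<noteq> 0 \<or> \<rho> * sin \<theta> \<noteq> 0"
    using \<rho> by auto
  then show ?thesis
    unfolding virial_def using pot_p.sign pot_q.sign pot_p.virial_nonneg pot_q.virial_nonneg
    by (metis add_pos_nonneg add_nonneg_pos)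
qed

lemma energy_deriv_radius: "((\<lambda>\<rho>. energy \<rho> \<theta>) has_real_derivative
    cos \<theta> * p (\<rho> * cos \<theta>) + sin \<theta> * q (\<rho> * sin \<theta>)) (at \<rho>)"
  unfolding energy_def
  by (rule derivative_eq_intros pot_p.deriv[THEN DERIV_chain2] pot_q.deriv[THEN DERIV_chain2] refl)+
     (simp add: algebra_simps)

lemma energy_has_derivative: "((\<lambda>(\<rho>, \<theta>). energy \<rho> \<theta>) has_derivative
    (\<lambda>(d\<rho>, d\<theta>). virial \<rho> \<theta> / \<rho> * d\<rho>
        + \<rho> * (q (\<rho> * sin \<theta>) * cos \<theta> - p (\<rho> * cos \<theta>) * sin \<theta>) * d\<theta>)) (at (\<rho>, \<theta>))"
  if "\<rho> > 0"
proof -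
  have P: "(P has_derivative (*) (p x)) (at x)" and Q: "(Q has_derivative (*) (q x)) (at x)" for x
    using pot_p.deriv[of x] pot_q.deriv[of x] by (auto simp: has_field_derivative_def)
  have cos: "((\<lambda>z::real\<times>real. P (fst z * cos (snd z))) has_derivative
     (\<lambda>d. p (\<rho> * cos \<theta>) * (\<rho> * (- sin \<theta> * snd d) + fst d * cos \<theta>))) (at (\<rho>, \<theta>))"
    by (rule has_derivative_compose[where g = P, OF _ P, THEN has_derivative_eq_rhs])
       (auto intro!: derivative_eq_intros has_derivative_fst has_derivative_snd simp: fun_eq_iff)
  have sin: "((\<lambda>z::real\<times>real. Q (fst z * sin (snd z))) has_derivative
     (\<lambda>d. q (\<rho> * sin \<theta>) * (\<rho> * (cos \<theta> * snd d) + fst d * sin \<theta>))) (at (\<rho>, \<theta>))"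
    by (rule has_derivative_compose[where g = Q, OF _ Q, THEN has_derivative_eq_rhs])
       (auto intro!: derivative_eq_intros has_derivative_fst has_derivative_snd simp: fun_eq_iff)
  show ?thesis
    unfolding energy_def case_prod_beta
    by (rule has_derivative_eq_rhs[OF has_derivative_add[OF cos sin]])
       (use that in \<open>auto simp: fun_eq_iff virial_def field_simps\<close>)
qed

lemma energy_strict_mono: "0 \<le> \<rho> \<Longrightarrow> \<rho> < \<rho>' \<Longrightarrow> energy \<rho> \<theta> < energy \<rho>' \<theta>"
proof (rule DERIV_pos_imp_increasing_open[where f = "\<lambda>\<rho>. energy \<rho> \<theta>"])
  fix r assume "0 \<le> \<rho>" "\<rho> < r"
  then have "0 < r * (cos \<theta> * p (r * cos \<theta>) + sin \<theta> * q (r * sin \<theta>))"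
    using virial_pos[of r \<theta>] by (simp add: virial_def algebra_simps)
  then have "0 < cos \<theta> * p (r * cos \<theta>) + sin \<theta> * q (r * sin \<theta>)"
    using \<open>0 \<le> \<rho>\<close> \<open>\<rho> < r\<close> by (simp add: zero_less_mult_iff)
  then show "\<exists>d. ((\<lambda>\<rho>. energy \<rho> \<theta>) has_real_derivative d) (at r) \<and> 0 < d"
    using energy_deriv_radius by blast
qed (auto intro!: continuous_at_imp_continuous_on DERIV_isCont[OF energy_deriv_radius])

text \<open>Lower and upper bounds that are uniform in the angle: they locate whole energy levels outside or
inside a given circle.\<close>
lemma energy_ge_min: "\<rho> \<ge> 0 \<Longrightarrow> min (P (\<rho> / 2)) (Q (\<rho> / 2)) \<le> energy \<rho> \<theta>"
proof -
  assume \<rho>: "\<rho> \<ge> 0"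
  from abs_cos_or_sin_ge_half[of \<theta>] show ?thesis
  proof
    assume "1 / 2 \<le> \<bar>cos \<theta>\<bar>"
    then have "P (\<rho> / 2) \<le> P (\<rho> * cos \<theta>)"
      using \<rho> mult_left_mono[of "1/2" "\<bar>cos \<theta>\<bar>" \<rho>] by (intro pot_p.mono) (simp add: abs_mult)
    then show ?thesis
      using pot_q.nonneg[of "\<rho> * sin \<theta>"] by (simp add: energy_def)
  next
    assume "1 / 2 \<le> \<bar>sin \<theta>\<bar>"
    then have "Q (\<rho> / 2) \<le> Q (\<rho> * sin \<theta>)"
      using \<rho> mult_left_mono[of "1/2" "\<bar>sin \<theta>\<bar>" \<rho>] by (intro pot_q.mono) (simp add: abs_mult)
    then show ?thesis
      using pot_p.nonneg[of "\<rho> * cos \<theta>"] by (simp add: energy_def)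
  qed
qed

lemma energy_le_sum: "\<rho> \<ge> 0 \<Longrightarrow> energy \<rho> \<theta> \<le> P \<rho> + Q \<rho>"
  unfolding energy_def
  by (intro add_mono pot_p.mono pot_q.mono) (auto simp: abs_mult mult_left_le)

definition radius :: "real \<Rightarrow> real \<Rightarrow> real" where
  "radius h \<theta> = (THE \<rho>. \<rho> > 0 \<and> energy \<rho> \<theta> = h)"

lemma radius_energy: "\<rho> > 0 \<Longrightarrow> radius (energy \<rho> \<theta>) \<theta> = \<rho>"
  unfolding radius_def
  by (rule the_equality) (auto, metis energy_strict_mono less_imp_le linorder_neqE_linordered_idom less_irrefl)

lemma radius: assumes "h > 0" shows "radius h \<theta> > 0" "energy (radius h \<theta>) \<theta> = h"
proof -
  obtain M N where MN: "M > 0" "P M \<ge> h" "N > 0" "Q N \<ge> h"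
    using pot_p.exceeds pot_q.exceeds by metis
  (* At this radius one coordinate is at least max M N in absolute value. *)
  define \<rho> where "\<rho> = 2 * max M N"
  have "h \<le> min (P (\<rho> / 2)) (Q (\<rho> / 2))"
    using MN pot_p.mono[of M "\<rho> / 2"] pot_q.mono[of N "\<rho> / 2"] by (simp add: \<rho>_def)
  also have "\<dots> \<le> energy \<rho> \<theta>"
    using MN by (intro energy_ge_min) (simp add: \<rho>_def)
  finally have "\<exists>r. 0 \<le> r \<and> r \<le> \<rho> \<and> energy r \<theta> = h"
    using assms MN
    by (intro IVT') (auto simp: \<rho>_def energy_def[of 0] pot_p.zero pot_q.zero
        intro!: continuous_at_imp_continuous_on DERIV_isCont[OF energy_deriv_radius])
  then obtain r where r: "r \<ge> 0" "energy r \<theta> = h" by blast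
  moreover have "r \<noteq> 0"
    using r assms by (auto simp: energy_def pot_p.zero pot_q.zero)
  ultimately show "radius h \<theta> > 0" "energy (radius h \<theta>) \<theta> = h"
    using radius_energy[of r \<theta>] by auto
qed

text \<open>The map \<open>(\<rho>, \<theta>) \<mapsto> (energy \<rho> \<theta>, \<theta>)\<close> is injective for \<open>\<rho> > 0\<close>, with inverse
\<open>(h, \<theta>) \<mapsto> (radius h \<theta>, \<theta>)\<close> and invertible derivative. The inverse function theorem
thus gives differentiability of the radius in both arguments at once, which serves twice: as the
derivative along a level, and as joint continuity when the level varies.\<close>
lemma radius_has_derivative:
  fixes h \<theta> :: real
  assumes h: "h > 0"
  defines "r \<equiv> radius h \<theta>"
  shows "((\<lambda>(h, \<theta>). radius h \<theta>) has_derivative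
    (\<lambda>(dh, d\<theta>). (dh - r * (q (r * sin \<theta>) * cos \<theta> - p (r * cos \<theta>) * sin \<theta>) * d\<theta>)
        * (r / virial r \<theta>))) (at (h, \<theta>))"
proof -
  have r: "r > 0" "energy r \<theta> = h"
    using radius[OF h] by (auto simp: r_def)
  let ?S = "{0<..} \<times> UNIV :: (real \<times> real) set"
  let ?f = "\<lambda>z. ((\<lambda>(\<rho>, \<theta>). energy \<rho> \<theta>) z, snd z)"
  let ?g = "\<lambda>z. ((\<lambda>(h, \<theta>). radius h \<theta>) z, snd z)"
  let ?u = "r * (q (r * sin \<theta>) * cos \<theta> - p (r * cos \<theta>) * sin \<theta>)"
  have df: "(?f has_derivative (\<lambda>d. ((\<lambda>(d\<rho>, d\<theta>). virial \<rho> \<theta> / \<rho> * d\<rho>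
        + \<rho> * (q (\<rho> * sin \<theta>) * cos \<theta> - p (\<rho> * cos \<theta>) * sin \<theta>) * d\<theta>) d, snd d))) (at (\<rho>, \<theta>))"
    if "\<rho> > 0" for \<rho> \<theta>
    by (intro has_derivative_Pair energy_has_derivative that derivative_intros)
  have "(?g has_derivative (\<lambda>d. ((\<lambda>(dh, d\<theta>). (dh - ?u * d\<theta>) * (r / virial r \<theta>)) d, snd d)))
      (at (?f (r, \<theta>)))"
  proof (rule has_derivative_inverse_strong[where S = ?S, OF _ _ _ _ df])
    show "open ?S" by (intro open_Times) auto
    show "continuous_on ?S ?f"
      by (rule continuous_at_imp_continuous_on) (auto intro!: has_derivative_continuous df)
  qed (use r virial_pos[of r \<theta>] in \<open>auto simp: radius_energy fun_eq_iff\<close>)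
  from has_derivative_fst[OF this] show ?thesis
    by (simp add: r)
qed

lemma radius_deriv:
  assumes "h > 0"
  defines "r \<equiv> radius h"
  shows "(r has_real_derivative
    - ((r \<theta>)\<^sup>2 * (q (r \<theta> * sin \<theta>) * cos \<theta> - p (r \<theta> * cos \<theta>) * sin \<theta>) / virial (r \<theta>) \<theta>)) (at \<theta>)"
proof -
  have "((\<lambda>\<theta>. (h, \<theta>)) has_derivative (\<lambda>d. (0, d))) (at \<theta>)"
    by (intro derivative_intros)
  note deriv = has_derivative_compose[OF this radius_has_derivative[OF \<open>h > 0\<close>], unfolded prod.case]
  show ?thesis
    unfolding has_field_derivative_def r_def
    by (rule has_derivative_eq_rhs[OF deriv]) (simp add: fun_eq_iff power2_eq_square)
qed

lemma radius_continuous: "continuous_on ({0<..} \<times> UNIV) (\<lambda>(h, \<theta>). radius h \<theta>)"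
  by (rule continuous_at_imp_continuous_on)
     (auto intro: has_derivative_continuous[OF radius_has_derivative])

lemma radius_plus_pi: "radius h (\<theta> + pi) = radius h \<theta>"
  by (simp add: radius_def energy_def pot_p.even pot_q.even)

lemma radius_le: "radius h \<theta> \<le> \<rho>"
  if "h > 0" "\<rho> > 0" "h \<le> P (\<rho> / 2)" "h \<le> Q (\<rho> / 2)"
proof (rule ccontr)
  assume "\<not> ?thesis"
  then have "energy \<rho> \<theta> < h"
    using energy_strict_mono[of \<rho> "radius h \<theta>" \<theta>] radius[of h \<theta>] that by simp
  then show False
    using energy_ge_min[of \<rho> \<theta>] that by simp
qed

lemma radius_ge: "\<rho> \<le> radius h \<theta>" if "h > 0" "P \<rho> + Q \<rho> \<le> h"
proof (rule ccontr)
  assume "\<not> ?thesis"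
  then have "h < energy \<rho> \<theta>" "\<rho> > 0"
    using energy_strict_mono[of "radius h \<theta>" \<rho> \<theta>] radius[of h \<theta>] that by auto
  then show False
    using energy_le_sum[of \<rho> \<theta>] that by simp
qed

section \<open>The half period and the solution on an energy level\<close>

text \<open>The reciprocal of the angular velocity.\<close>
definition time_density :: "real \<Rightarrow> real \<Rightarrow> real" where
  "time_density h \<theta> = (radius h \<theta>)\<^sup>2 / virial (radius h \<theta>) \<theta>"

definition half_period :: "real \<Rightarrow> real" where
  "half_period h = integral {0..pi} (time_density h)"

lemma time_density_pos: "h > 0 \<Longrightarrow> time_density h \<theta> > 0"
  using radius[of h \<theta>] virial_pos[of "radius h \<theta>" \<theta>] by (simp add: time_density_def)

lemma time_density_plus_pi: "time_density h (\<theta> + pi) = time_density h \<theta>"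
  by (simp add: time_density_def virial_def radius_plus_pi pot_p.odd pot_q.odd)

lemma time_density_continuous:
  "continuous_on ({0<..} \<times> UNIV) (\<lambda>(h, \<theta>). time_density h \<theta>)"
proof -
  have r: "continuous_on ({0<..} \<times> UNIV) (\<lambda>z. radius (fst z) (snd z))"
    using radius_continuous by (simp add: case_prod_beta)
  have "continuous_on ({0<..} \<times> UNIV) (\<lambda>z. virial (radius (fst z) (snd z)) (snd z))"
    unfolding virial_def
    by (intro continuous_intros r continuous_on_compose2[OF pot_p.cont]
        continuous_on_compose2[OF pot_q.cont]) auto
  moreover have "virial (radius (fst z) (snd z)) (snd z) \<noteq> 0" if "z \<in> {0<..} \<times> UNIV" for z
    using that virial_pos[OF radius(1), of "fst z"] by (auto simp: less_imp_neq[symmetric])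
  ultimately show ?thesis
    unfolding time_density_def case_prod_beta by (intro continuous_intros r) auto
qed

lemma time_density_continuous_angle: "h > 0 \<Longrightarrow> continuous_on S (time_density h)"
  using continuous_on_compose2[OF time_density_continuous continuous_on_Pair[OF continuous_on_const continuous_on_id]]
  by fastforce

lemma half_period_continuous: "continuous_on {0<..} half_period"
  unfolding half_period_def
  using integral_continuous_on_param[of "{0<..}" 0 pi time_density]
  by (auto intro: continuous_on_subset[OF time_density_continuous])

text \<open>Follow the level with the angle \<open>\<Theta>(t)\<close> that solves \<open>\<Theta>' = 1 / time_density h \<Theta>\<close>. The
period is minimal already for \<open>x\<close> alone: the energy makes \<open>x\<close> attain the value \<open>x 0\<close> only
where \<open>y = 0\<close>, that is, at multiples of a half turn, and after one half turn \<open>x\<close> is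
negative.\<close>
lemma symmetric_solution:
  assumes h: "h > 0"
  obtains x y where
    "\<And>t. (x has_real_derivative - q (y t)) (at t)"
    "\<And>t. (y has_real_derivative p (x t)) (at t)"
    "\<And>t. x (t + half_period h) = - x t"
    "\<And>t. y (t + half_period h) = - y t"
    "\<And>t. 0 < t \<Longrightarrow> t < 2 * half_period h \<Longrightarrow> x t \<noteq> x 0"
proof -
  define T where "T = half_period h"
  define r where "r = radius h"
  have r: "r \<theta> > 0" "energy (r \<theta>) \<theta> = h" for \<theta>
    using radius[OF h] by (auto simp: r_def)
  obtain \<Theta> where \<Theta>0: "\<Theta> 0 = 0"
    and d\<Theta>: "\<And>t. (\<Theta> has_real_derivative 1 / time_density h (\<Theta> t)) (at t)"
    and \<Theta>T: "\<And>t. \<Theta> (t + T) = \<Theta> t + pi"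
    using quasiperiodic_time_change[of "time_density h" pi] time_density_continuous_angle[OF h]
      time_density_pos[OF h] time_density_plus_pi unfolding T_def half_period_def
    by (metis pi_gt_zero)
  have \<Theta>_mono: "\<Theta> s < \<Theta> t" if "s < t" for s t
    by (rule DERIV_pos_imp_increasing[OF that])
       (use d\<Theta> time_density_pos[OF h] in \<open>metis zero_less_divide_1_iff\<close>)
  define x where "x t = r (\<Theta> t) * cos (\<Theta> t)" for t
  define y where "y t = r (\<Theta> t) * sin (\<Theta> t)" for t
  let ?r' = "\<lambda>\<theta>. - ((r \<theta>)\<^sup>2 * (q (r \<theta> * sin \<theta>) * cos \<theta> - p (r \<theta> * cos \<theta>) * sin \<theta>) / virial (r \<theta>) \<theta>)"
  have dr: "(r has_real_derivative ?r' \<theta>) (at \<theta>)" for \<theta>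
    using radius_deriv[OF h] by (simp add: r_def)
  have V: "virial (r \<theta>) \<theta> > 0" for \<theta>
    using virial_pos r by blast
  show thesis
  proof (rule that[of x y, folded T_def])
    fix t
    let ?\<theta> = "\<Theta> t"
    have dens: "1 / time_density h ?\<theta> = virial (r ?\<theta>) ?\<theta> / (r ?\<theta>)\<^sup>2"
      by (simp add: time_density_def r_def)
    have "((\<lambda>\<theta>. r \<theta> * cos \<theta>) has_real_derivative
        - q (y t) * ((r ?\<theta>)\<^sup>2 / virial (r ?\<theta>) ?\<theta>)) (at ?\<theta>)"
    proof (rule DERIV_cong[OF DERIV_mult[OF dr DERIV_cos]])
      have "?r' ?\<theta> * cos ?\<theta> + - sin ?\<theta> * r ?\<theta> =
         (- (r ?\<theta>)\<^sup>2 * (q (y t) * cos ?\<theta> - p (x t) * sin ?\<theta>) * cos ?\<theta>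
           - sin ?\<theta> * r ?\<theta> * virial (r ?\<theta>) ?\<theta>) / virial (r ?\<theta>) ?\<theta>"
        using V[of ?\<theta>] by (simp add: x_def y_def field_simps)
      also have "- (r ?\<theta>)\<^sup>2 * (q (y t) * cos ?\<theta> - p (x t) * sin ?\<theta>) * cos ?\<theta>
           - sin ?\<theta> * r ?\<theta> * virial (r ?\<theta>) ?\<theta> = - q (y t) * (r ?\<theta>)\<^sup>2 * ((cos ?\<theta>)\<^sup>2 + (sin ?\<theta>)\<^sup>2)"
        unfolding virial_def x_def y_def by (simp add: algebra_simps power2_eq_square del: sin_cos_squared_add2 sin_cos_squared_add3)
      finally show "?r' ?\<theta> * cos ?\<theta> + - sin ?\<theta> * r ?\<theta> = - q (y t) * ((r ?\<theta>)\<^sup>2 / virial (r ?\<theta>) ?\<theta>)"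
        by simp
    qed
    from DERIV_chain2[OF this d\<Theta>] show "(x has_real_derivative - q (y t)) (at t)"
      unfolding x_def dens using V[of ?\<theta>] r(1)[of ?\<theta>] by simp
    have "((\<lambda>\<theta>. r \<theta> * sin \<theta>) has_real_derivative
        p (x t) * ((r ?\<theta>)\<^sup>2 / virial (r ?\<theta>) ?\<theta>)) (at ?\<theta>)"
    proof (rule DERIV_cong[OF DERIV_mult[OF dr DERIV_sin]])
      have "?r' ?\<theta> * sin ?\<theta> + cos ?\<theta> * r ?\<theta> =
         (- (r ?\<theta>)\<^sup>2 * (q (y t) * cos ?\<theta> - p (x t) * sin ?\<theta>) * sin ?\<theta>
           + cos ?\<theta> * r ?\<theta> * virial (r ?\<theta>) ?\<theta>) / virial (r ?\<theta>) ?\<theta>"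
        using V[of ?\<theta>] by (simp add: x_def y_def field_simps)
      also have "- (r ?\<theta>)\<^sup>2 * (q (y t) * cos ?\<theta> - p (x t) * sin ?\<theta>) * sin ?\<theta>
           + cos ?\<theta> * r ?\<theta> * virial (r ?\<theta>) ?\<theta> = p (x t) * (r ?\<theta>)\<^sup>2 * ((cos ?\<theta>)\<^sup>2 + (sin ?\<theta>)\<^sup>2)"
        unfolding virial_def x_def y_def by (simp add: algebra_simps power2_eq_square del: sin_cos_squared_add2 sin_cos_squared_add3)
      finally show "?r' ?\<theta> * sin ?\<theta> + cos ?\<theta> * r ?\<theta> = p (x t) * ((r ?\<theta>)\<^sup>2 / virial (r ?\<theta>) ?\<theta>)"
        by simp
    qed
    from DERIV_chain2[OF this d\<Theta>] show "(y has_real_derivative p (x t)) (at t)"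
      unfolding y_def dens using V[of ?\<theta>] r(1)[of ?\<theta>] by simp
  next
    show "x (t + T) = - x t" "y (t + T) = - y t" for t
      by (simp_all add: x_def y_def \<Theta>T r_def radius_plus_pi)
  next
    fix t assume t: "0 < t" "t < 2 * T"
    have "\<Theta> (2 * T) = 2 * pi"
      using \<Theta>T[of 0] \<Theta>T[of T] \<Theta>0 by simp
    then have range: "0 < \<Theta> t" "\<Theta> t < 2 * pi"
      using \<Theta>_mono[OF t(1)] \<Theta>_mono[OF t(2)] \<Theta>0 by auto
    show "x t \<noteq> x 0"
    proof
      assume eq: "x t = x 0"
      have "P (x t) + Q (y t) = P (x 0) + Q (y 0)"
        using r(2)[of "\<Theta> t"] r(2)[of "\<Theta> 0"] by (simp add: energy_def x_def y_def)
      then have "Q (y t) = 0"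
        using eq \<Theta>0 by (simp add: y_def pot_q.zero)
      then have "sin (\<Theta> t) = 0"
        using pot_q.pos[of "y t"] r(1)[of "\<Theta> t"] by (force simp: y_def)
      then have "\<Theta> t = pi"
        using range sin_gt_zero[of "\<Theta> t"] sin_lt_zero[of "\<Theta> t"] by fastforce
      then have "x t < 0"
        using r(1)[of pi] by (simp add: x_def)
      moreover have "x 0 > 0"
        using r(1)[of 0] \<Theta>0 by (simp add: x_def)
      ultimately show False
        using eq by simp
    qed
  qed
qed

section \<open>Comparison with linear oscillators\<close>

lemma half_period_ge:
  assumes h: "h > 0" and pos: "\<alpha> > 0" "\<beta> > 0"
    and bound: "\<And>\<theta>. virial (radius h \<theta>) \<theta>
      \<le> \<alpha> * (radius h \<theta> * cos \<theta>)\<^sup>2 + \<beta> * (radius h \<theta> * sin \<theta>)\<^sup>2"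
  shows "pi / sqrt (\<alpha> * \<beta>) \<le> half_period h"
  unfolding half_period_def
proof (rule has_integral_le[OF ellipse_angle_integral[OF pos] integrable_integral])
  show "time_density h integrable_on {0..pi}"
    by (intro integrable_continuous_real time_density_continuous_angle h)
next
  fix \<theta>
  let ?r = "radius h \<theta>"
  have r: "?r > 0" "virial ?r \<theta> > 0"
    using radius[OF h] virial_pos by auto
  have eq: "\<alpha> * (?r * cos \<theta>)\<^sup>2 + \<beta> * (?r * sin \<theta>)\<^sup>2 = ?r\<^sup>2 * (\<alpha> * (cos \<theta>)\<^sup>2 + \<beta> * (sin \<theta>)\<^sup>2)"
    by (simp add: power_mult_distrib algebra_simps)
  then have "1 / (\<alpha> * (cos \<theta>)\<^sup>2 + \<beta> * (sin \<theta>)\<^sup>2) = ?r\<^sup>2 / (\<alpha> * (?r * cos \<theta>)\<^sup>2 + \<beta> * (?r * sin \<theta>)\<^sup>2)"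
    using r by simp
  also have "\<dots> \<le> time_density h \<theta>"
    unfolding time_density_def using bound[of \<theta>] r by (intro divide_left_mono) auto
  finally show "1 / (\<alpha> * (cos \<theta>)\<^sup>2 + \<beta> * (sin \<theta>)\<^sup>2) \<le> time_density h \<theta>" .
qed

lemma half_period_le:
  assumes h: "h > 0" and pos: "\<alpha> > 0" "\<beta> > 0"
    and bound: "\<And>\<theta>. \<alpha> * (radius h \<theta> * cos \<theta>)\<^sup>2 + \<beta> * (radius h \<theta> * sin \<theta>)\<^sup>2
      \<le> virial (radius h \<theta>) \<theta>"
  shows "half_period h \<le> pi / sqrt (\<alpha> * \<beta>)"
  unfolding half_period_def
proof (rule has_integral_le[OF integrable_integral ellipse_angle_integral[OF pos]])
  show "time_density h integrable_on {0..pi}"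
    by (intro integrable_continuous_real time_density_continuous_angle h)
next
  fix \<theta>
  let ?r = "radius h \<theta>"
  have r: "?r > 0"
    using radius[OF h] by auto
  have eq: "\<alpha> * (?r * cos \<theta>)\<^sup>2 + \<beta> * (?r * sin \<theta>)\<^sup>2 = ?r\<^sup>2 * (\<alpha> * (cos \<theta>)\<^sup>2 + \<beta> * (sin \<theta>)\<^sup>2)"
    by (simp add: power_mult_distrib algebra_simps)
  have "cos \<theta> \<noteq> 0 \<or> sin \<theta> \<noteq> 0"
    using sin_cos_squared_add[of \<theta>] by (auto simp del: sin_cos_squared_add)
  then have "\<alpha> * (cos \<theta>)\<^sup>2 + \<beta> * (sin \<theta>)\<^sup>2 > 0"
    using pos by (auto intro: add_pos_nonneg add_nonneg_pos)
  then have "\<alpha> * (?r * cos \<theta>)\<^sup>2 + \<beta> * (?r * sin \<theta>)\<^sup>2 > 0"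
    unfolding eq using r by simp
  then have "time_density h \<theta> \<le> ?r\<^sup>2 / (\<alpha> * (?r * cos \<theta>)\<^sup>2 + \<beta> * (?r * sin \<theta>)\<^sup>2)"
    unfolding time_density_def using bound[of \<theta>] by (intro divide_left_mono) auto
  also have "\<dots> = 1 / (\<alpha> * (cos \<theta>)\<^sup>2 + \<beta> * (sin \<theta>)\<^sup>2)"
    unfolding eq using r by simp
  finally show "time_density h \<theta> \<le> 1 / (\<alpha> * (cos \<theta>)\<^sup>2 + \<beta> * (sin \<theta>)\<^sup>2)" .
qed

text \<open>Here and below, \<open>d\<close> and \<open>e\<close> stand for \<open>\<alpha> x\<^sup>2 - x p(x)\<close> and \<open>\<beta> y\<^sup>2 - y q(y)\<close>, or
for their negatives, so that slow and fast levels are treated together.\<close>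
lemma defect_nonneg_near_zero:
  fixes d e :: "real \<Rightarrow> real"
  assumes "\<forall>\<^sub>F x in at 0. 0 \<le> d x" "\<forall>\<^sub>F x in at 0. 0 \<le> e x" "d 0 = 0" "e 0 = 0"
  shows "\<exists>h>0. \<forall>\<theta>. 0 \<le> d (radius h \<theta> * cos \<theta>) + e (radius h \<theta> * sin \<theta>)"
proof -
  have "\<forall>\<^sub>F x in at 0. 0 \<le> d x \<and> 0 \<le> e x"
    using assms by (simp add: eventually_conj)
  then obtain \<delta> where \<delta>: "\<delta> > 0" "\<And>x. x \<noteq> 0 \<Longrightarrow> \<bar>x\<bar> < \<delta> \<Longrightarrow> 0 \<le> d x \<and> 0 \<le> e x"
    by (auto simp: eventually_at dist_real_def)
  have nonneg: "0 \<le> d x \<and> 0 \<le> e x" if "\<bar>x\<bar> < \<delta>" for x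
    using \<delta>(2)[of x] assms that by (cases "x = 0") auto
  (* Energies up to this value keep the radius within \<delta> / 2. *)
  define h where "h = min (P (\<delta> / 4)) (Q (\<delta> / 4))"
  have h: "h > 0"
    using \<delta>(1) pot_p.pos[of "\<delta> / 4"] pot_q.pos[of "\<delta> / 4"] by (simp add: h_def)
  have "0 \<le> d (radius h \<theta> * cos \<theta>) + e (radius h \<theta> * sin \<theta>)" for \<theta>
  proof -
    have "radius h \<theta> \<le> \<delta> / 2"
      using h \<delta>(1) by (intro radius_le) (auto simp: h_def)
    then have "radius h \<theta> * \<bar>u\<bar> < \<delta>" if "\<bar>u\<bar> \<le> 1" for u
      using mult_left_mono[OF that, of "radius h \<theta>"] radius(1)[OF h, of \<theta>] \<delta>(1) by linarith
    then have "\<bar>radius h \<theta> * cos \<theta>\<bar> < \<delta>" "\<bar>radius h \<theta> * sin \<theta>\<bar> < \<delta>"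
      using radius(1)[OF h, of \<theta>] by (auto simp: abs_mult)
    then show ?thesis
      using nonneg by (simp add: add_nonneg_nonneg)
  qed
  then show ?thesis using h by blast
qed

text \<open>On a large level one coordinate may still be small, where nothing is known about its defect except
that it is bounded by continuity. So each defect is at least \<open>\<epsilon> x\<^sup>2\<close> minus a constant on the whole
line, and the sum over both coordinates is at least \<open>\<epsilon> \<rho>\<^sup>2\<close> minus a constant.\<close>
lemma defect_nonneg_near_infinity:
  fixes d e :: "real \<Rightarrow> real"
  assumes ev: "\<forall>\<^sub>F x in at_top. \<epsilon> * x\<^sup>2 \<le> d x" "\<forall>\<^sub>F x in at_top. \<epsilon> * x\<^sup>2 \<le> e x"
    and \<epsilon>: "\<epsilon> > 0" and cont: "continuous_on UNIV d" "continuous_on UNIV e"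
    and even: "\<And>x. d (- x) = d x" "\<And>x. e (- x) = e x"
  shows "\<exists>h>0. \<forall>\<theta>. 0 \<le> d (radius h \<theta> * cos \<theta>) + e (radius h \<theta> * sin \<theta>)"
proof -
  have lower: "\<exists>C. \<forall>x. \<epsilon> * x\<^sup>2 - C \<le> u x"
    if ev: "\<forall>\<^sub>F x in at_top. \<epsilon> * x\<^sup>2 \<le> u x" and cont: "continuous_on UNIV u"
      and even: "\<And>x. u (- x) = u x" for u :: "real \<Rightarrow> real"
  proof -
    obtain N where N: "\<And>x. x \<ge> N \<Longrightarrow> \<epsilon> * x\<^sup>2 \<le> u x"
      using ev by (auto simp: eventually_at_top_linorder)
    have "compact ((\<lambda>x. \<epsilon> * x\<^sup>2 - u x) ` {0..max 0 N})"
      by (intro compact_continuous_image continuous_intros continuous_on_subset[OF cont]) auto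
    then obtain C where C: "\<And>x. 0 \<le> x \<Longrightarrow> x \<le> max 0 N \<Longrightarrow> \<bar>\<epsilon> * x\<^sup>2 - u x\<bar> \<le> C"
      by (force dest!: compact_imp_bounded simp: bounded_iff)
    have "C \<ge> 0"
      using order_trans[OF abs_ge_zero C[of 0]] by simp
    then have "\<epsilon> * \<bar>x\<bar>\<^sup>2 - C \<le> u \<bar>x\<bar>" for x
      using N[of "\<bar>x\<bar>"] C[of "\<bar>x\<bar>"] by (cases "\<bar>x\<bar> \<le> max 0 N") (auto simp: not_le)
    moreover have "u \<bar>x\<bar> = u x" for x
      by (simp add: abs_if even)
    ultimately show ?thesis by auto
  qed
  obtain C where C: "\<And>x. \<epsilon> * x\<^sup>2 - C \<le> d x"
    using lower[OF ev(1) cont(1) even(1)] by blast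
  obtain C' where C': "\<And>x. \<epsilon> * x\<^sup>2 - C' \<le> e x"
    using lower[OF ev(2) cont(2) even(2)] by blast
  (* Beyond this radius the quadratic surplus outweighs both constants. *)
  define \<rho> where "\<rho> = sqrt (\<bar>C + C'\<bar> / \<epsilon>)"
  define h where "h = P \<rho> + Q \<rho> + 1"
  have h: "h > 0"
    using pot_p.nonneg[of \<rho>] pot_q.nonneg[of \<rho>] by (simp add: h_def)
  have "0 \<le> d (radius h \<theta> * cos \<theta>) + e (radius h \<theta> * sin \<theta>)" for \<theta>
  proof -
    let ?r = "radius h \<theta>"
    have "\<rho> \<le> ?r"
      by (rule radius_ge[OF h]) (simp add: h_def)
    then have "\<rho>\<^sup>2 \<le> ?r\<^sup>2"
      using \<epsilon> by (intro power_mono) (auto simp: \<rho>_def)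
    then have "C + C' \<le> \<epsilon> * ?r\<^sup>2"
      using \<epsilon> by (simp add: \<rho>_def field_simps)
    also have "\<dots> = \<epsilon> * (?r * cos \<theta>)\<^sup>2 + \<epsilon> * (?r * sin \<theta>)\<^sup>2"
      by (simp add: power_mult_distrib flip: distrib_left)
    finally show ?thesis
      using C[of "?r * cos \<theta>"] C'[of "?r * sin \<theta>"] by linarith
  qed
  then show ?thesis using h by blast
qed

lemma defect_nonneg_level:
  fixes d e :: "real \<Rightarrow> real"
  assumes F: "F = at 0 \<or> F = at_top"
    and ev: "\<forall>\<^sub>F x in F. \<epsilon> * x\<^sup>2 \<le> d x" "\<forall>\<^sub>F x in F. \<epsilon>' * x\<^sup>2 \<le> e x" and \<epsilon>: "\<epsilon> > 0" "\<epsilon>' > 0"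
    and cont: "continuous_on UNIV d" "continuous_on UNIV e"
    and even: "\<And>x. d (- x) = d x" "\<And>x. e (- x) = e x"
    and zero: "d 0 = 0" "e 0 = 0"
  obtains h where "h > 0" "\<And>\<theta>. 0 \<le> d (radius h \<theta> * cos \<theta>) + e (radius h \<theta> * sin \<theta>)"
proof -
  define \<eta> where "\<eta> = min \<epsilon> \<epsilon>'"
  have \<eta>: "\<eta> > 0" "\<eta> * x\<^sup>2 \<le> \<epsilon> * x\<^sup>2" "\<eta> * x\<^sup>2 \<le> \<epsilon>' * x\<^sup>2" for x
    using \<epsilon> by (auto simp: \<eta>_def intro: mult_right_mono)
  have ev': "\<forall>\<^sub>F x in F. \<eta> * x\<^sup>2 \<le> d x" "\<forall>\<^sub>F x in F. \<eta> * x\<^sup>2 \<le> e x"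
    using ev by (auto elim: eventually_mono intro: order_trans[OF \<eta>(2)] order_trans[OF \<eta>(3)])
  have "\<exists>h>0. \<forall>\<theta>. 0 \<le> d (radius h \<theta> * cos \<theta>) + e (radius h \<theta> * sin \<theta>)"
    using F
  proof
    assume F: "F = at 0"
    have nonneg: "0 \<le> z" if "\<eta> * x\<^sup>2 \<le> z" for x z
      using \<eta>(1) by (intro order_trans[OF _ that]) simp
    show ?thesis
      using eventually_mono[OF ev'(1) nonneg] eventually_mono[OF ev'(2) nonneg] zero
      unfolding F by (intro defect_nonneg_near_zero) auto
  next
    assume "F = at_top"
    then show ?thesis
      using ev' \<eta>(1) cont even by (intro defect_nonneg_near_infinity[of \<eta>]) auto
  qed
  then show thesis using that by blast
qed

text \<open>Bounds \<open>\<alpha>\<close>, \<open>\<beta>\<close> slightly above the limits still satisfy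
\<open>\<alpha> \<beta> < \<pi>\<^sup>2\<close>, so the comparison oscillator has half period more than \<open>1\<close>.\<close>
lemma slow_level:
  assumes F: "F = at 0 \<or> F = at_top"
    and lim: "((\<lambda>x. ereal (p x / x)) \<longlongrightarrow> a) F" "((\<lambda>y. ereal (q y / y)) \<longlongrightarrow> b) F"
    and nonneg: "0 \<le> a" "0 \<le> b"
    and defined: "\<not> (a = 0 \<and> b = \<infinity>)" "\<not> (a = \<infinity> \<and> b = 0)"
    and less: "a * b < ereal (pi\<^sup>2)"
  obtains h where "h > 0" "1 \<le> half_period h"
proof -
  obtain \<alpha> \<beta> where pos: "\<alpha> > 0" "\<beta> > 0" and ab: "a < ereal \<alpha>" "b < ereal \<beta>"
      and prod: "\<alpha> * \<beta> < pi\<^sup>2"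
    using ereal_mult_less_imp_real_bounds[OF nonneg less defined] by metis
  obtain \<epsilon> \<epsilon>' where ev: "\<epsilon> > 0" "\<forall>\<^sub>F x in F. \<epsilon> * x\<^sup>2 \<le> \<alpha> * x\<^sup>2 - x * p x"
      "\<epsilon>' > 0" "\<forall>\<^sub>F y in F. \<epsilon>' * y\<^sup>2 \<le> \<beta> * y\<^sup>2 - y * q y"
    using eventually_defect(1)[OF F lim(1) ab(1)] eventually_defect(1)[OF F lim(2) ab(2)] by blast
  obtain h where h: "h > 0" and def:
    "\<And>\<theta>. 0 \<le> (\<alpha> * (radius h \<theta> * cos \<theta>)\<^sup>2 - (radius h \<theta> * cos \<theta>) * p (radius h \<theta> * cos \<theta>))
      + (\<beta> * (radius h \<theta> * sin \<theta>)\<^sup>2 - (radius h \<theta> * sin \<theta>) * q (radius h \<theta> * sin \<theta>))"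
    by (rule defect_nonneg_level[OF F ev(2,4,1,3)])
       (auto intro!: continuous_intros pot_p.cont pot_q.cont simp: pot_p.odd pot_q.odd)
  have "virial (radius h \<theta>) \<theta> \<le> \<alpha> * (radius h \<theta> * cos \<theta>)\<^sup>2 + \<beta> * (radius h \<theta> * sin \<theta>)\<^sup>2" for \<theta>
    using def[of \<theta>] unfolding virial_def by linarith
  then have period: "pi / sqrt (\<alpha> * \<beta>) \<le> half_period h"
    by (rule half_period_ge[OF h pos])
  have "sqrt (\<alpha> * \<beta>) \<le> pi"
    using prod by (intro real_le_lsqrt) auto
  then have "1 \<le> pi / sqrt (\<alpha> * \<beta>)"
    using pos by simp
  then show thesis
    using that[of h] h period by simp
qed

lemma fast_level:
  assumes F: "F = at 0 \<or> F = at_top"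
    and lim: "((\<lambda>x. ereal (p x / x)) \<longlongrightarrow> a) F" "((\<lambda>y. ereal (q y / y)) \<longlongrightarrow> b) F"
    and nonneg: "0 \<le> a" "0 \<le> b"
    and less: "ereal (pi\<^sup>2) < a * b"
  obtains h where "h > 0" "half_period h \<le> 1"
proof -
  obtain \<alpha> \<beta> where pos: "\<alpha> > 0" "\<beta> > 0" and ab: "ereal \<alpha> < a" "ereal \<beta> < b"
      and prod: "pi\<^sup>2 < \<alpha> * \<beta>"
    using ereal_less_mult_imp_real_bounds[OF nonneg less] by auto
  obtain \<epsilon> \<epsilon>' where ev: "\<epsilon> > 0" "\<forall>\<^sub>F x in F. \<epsilon> * x\<^sup>2 \<le> x * p x - \<alpha> * x\<^sup>2"
      "\<epsilon>' > 0" "\<forall>\<^sub>F y in F. \<epsilon>' * y\<^sup>2 \<le> y * q y - \<beta> * y\<^sup>2"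
    using eventually_defect(2)[OF F lim(1) ab(1)] eventually_defect(2)[OF F lim(2) ab(2)] by blast
  obtain h where h: "h > 0" and def:
    "\<And>\<theta>. 0 \<le> ((radius h \<theta> * cos \<theta>) * p (radius h \<theta> * cos \<theta>) - \<alpha> * (radius h \<theta> * cos \<theta>)\<^sup>2)
      + ((radius h \<theta> * sin \<theta>) * q (radius h \<theta> * sin \<theta>) - \<beta> * (radius h \<theta> * sin \<theta>)\<^sup>2)"
    by (rule defect_nonneg_level[OF F ev(2,4,1,3)])
       (auto intro!: continuous_intros pot_p.cont pot_q.cont simp: pot_p.odd pot_q.odd)
  have "\<alpha> * (radius h \<theta> * cos \<theta>)\<^sup>2 + \<beta> * (radius h \<theta> * sin \<theta>)\<^sup>2 \<le> virial (radius h \<theta>) \<theta>" for \<theta>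
    using def[of \<theta>] unfolding virial_def by linarith
  then have period: "half_period h \<le> pi / sqrt (\<alpha> * \<beta>)"
    by (rule half_period_le[OF h pos])
  have "pi \<le> sqrt (\<alpha> * \<beta>)"
    using prod by (intro real_le_rsqrt) auto
  then have "pi / sqrt (\<alpha> * \<beta>) \<le> 1"
    using pos by simp
  then show thesis
    using that[of h] h period by simp
qed

section \<open>A level with half period one\<close>

lemma half_period_attains:
  assumes "h\<^sub>1 > 0" "half_period h\<^sub>1 \<le> T" "h\<^sub>2 > 0" "T \<le> half_period h\<^sub>2"
  obtains h where "h > 0" "half_period h = T"
proof -
  have "connected (half_period ` {0<..})"
    by (intro connected_continuous_image half_period_continuous) simp
  then have "{half_period h\<^sub>1..half_period h\<^sub>2} \<subseteq> half_period ` {0<..}"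
    using assms by (intro connected_contains_Icc) auto
  then have "T \<in> half_period ` {0<..}"
    using assms by (meson atLeastAtMost_iff subsetD)
  then show thesis
    using that by auto
qed

end

lemma has_minimal_periodI:
  assumes "T > 0" "\<And>t. u (t + T) = u t" "\<And>S. 0 < S \<Longrightarrow> S < T \<Longrightarrow> u S \<noteq> u 0"
  shows "has_minimal_period u T"
proof -
  have "\<not> periodic_fun_simple u S" if "0 < S" "S < T" for S
    using assms(3)[OF that] periodic_fun_simple.plus_period[of u S 0] by auto
  moreover have "periodic_fun_simple u T"
    by unfold_locales (rule assms(2))
  ultimately show ?thesis
    using assms(1) by (simp add: has_minimal_period_def)
qed

theorem theorem10:
  fixes f g :: "real \<Rightarrow> real" and a A b B :: ereal
  assumes cont: "continuous_on UNIV f" "continuous_on UNIV g"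
    and odd: "\<And>x. f (- x) = - f x" "\<And>x. g (- x) = - g x"
    and sign: "\<And>x. x \<noteq> 0 \<Longrightarrow> x * f x > 0" "\<And>x. x \<noteq> 0 \<Longrightarrow> x * g x > 0"
    and zero: "f 0 = 0" "g 0 = 0"
    and range: "0 \<le> a" "0 \<le> A" "0 \<le> b" "0 \<le> B"
    and lim_a: "((\<lambda>x. ereal (f x / x)) \<longlongrightarrow> a) (at 0)"
    and lim_A: "((\<lambda>x. ereal (f x / x)) \<longlongrightarrow> A) at_top"
    and lim_b: "((\<lambda>y. ereal (g y / y)) \<longlongrightarrow> b) (at 0)"
    and lim_B: "((\<lambda>y. ereal (g y / y)) \<longlongrightarrow> B) at_top"
    and int_f: "filterlim (\<lambda>x. integral {0..x} f) at_top at_top"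
    and int_g: "filterlim (\<lambda>x. integral {0..x} g) at_top at_top"
    and ab_defined: "\<not> (a = 0 \<and> b = \<infinity>)" "\<not> (a = \<infinity> \<and> b = 0)"
    and AB_defined: "\<not> (A = 0 \<and> B = \<infinity>)" "\<not> (A = \<infinity> \<and> B = 0)"
    and cases: "(a * b < ereal (pi\<^sup>2 / 2) \<and> ereal (pi\<^sup>2 / 2) < A * B) \<or>
                (A * B < ereal (pi\<^sup>2 / 2) \<and> ereal (pi\<^sup>2 / 2) < a * b)"
  shows "(\<exists>\<Gamma>. closed_orbit f g 2 \<Gamma>) \<and> (\<exists>x. SSPS f g x)"
proof -
  obtain F where F: "\<And>x. (F has_real_derivative f x) (at x)" "F 0 = 0"
    using continuous_has_antiderivative[OF cont(1)] by metis
  obtain G where G: "\<And>x. (G has_real_derivative g x) (at x)" "G 0 = 0"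
    using continuous_has_antiderivative[OF cont(2)] by metis
  have F_unbounded: "filterlim F at_top at_top"
  proof (rule filterlim_mono_eventually[OF int_f])
    show "\<forall>\<^sub>F x in at_top. integral {0..x} f = F x"
      using eventually_ge_at_top[of 0]
      by eventually_elim (simp add: integral_eq_antiderivative_diff[OF F(1)] F(2))
  qed auto
  have G_unbounded: "filterlim G at_top at_top"
  proof (rule filterlim_mono_eventually[OF int_g])
    show "\<forall>\<^sub>F x in at_top. integral {0..x} g = G x"
      using eventually_ge_at_top[of 0]
      by eventually_elim (simp add: integral_eq_antiderivative_diff[OF G(1)] G(2))
  qed auto
  interpret pot_f: confining_potential "\<lambda>x. 2 * f x" "\<lambda>x. 2 * F x"
  proof
    show "((\<lambda>x. 2 * F x) has_real_derivative 2 * f x) (at x)" for x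
      by (intro DERIV_cmult F)
    show "0 < x * (2 * f x)" if "x \<noteq> 0" for x
      using sign(1)[OF that] by (simp add: mult.left_commute)
    show "filterlim (\<lambda>x. 2 * F x) at_top at_top"
      by (rule filterlim_tendsto_pos_mult_at_top[OF tendsto_const _ F_unbounded]) simp
    show "continuous_on UNIV (\<lambda>x. 2 * f x)"
      by (intro continuous_on_mult_left cont)
  qed (simp_all add: odd F(2))
  interpret pot_g: confining_potential g G
    by standard (fact G odd sign cont G_unbounded)+
  interpret oscillator "\<lambda>x. 2 * f x" "\<lambda>x. 2 * F x" g G ..

  have lim2: "((\<lambda>x. ereal (2 * f x / x)) \<longlongrightarrow> 2 * l) \<F>"
    if "((\<lambda>x. ereal (f x / x)) \<longlongrightarrow> l) \<F>" for l \<F>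
    using tendsto_cmult_ereal[of 2, OF _ that] by simp
  have double: "2 * z < ereal (pi\<^sup>2) \<longleftrightarrow> z < ereal (pi\<^sup>2 / 2)"
    "ereal (pi\<^sup>2) < 2 * z \<longleftrightarrow> ereal (pi\<^sup>2 / 2) < z" for z :: ereal
    by (cases z; auto)+
  have prod2: "2 * l * m < ereal (pi\<^sup>2) \<longleftrightarrow> l * m < ereal (pi\<^sup>2 / 2)"
    "ereal (pi\<^sup>2) < 2 * l * m \<longleftrightarrow> ereal (pi\<^sup>2 / 2) < l * m" for l m :: ereal
    by (simp_all only: mult.assoc double)
  have zero_infty: "2 * l = 0 \<longleftrightarrow> l = 0" "2 * l = \<infinity> \<longleftrightarrow> l = \<infinity>" for l :: ereal
    by (cases l; simp)+
  have nonneg2: "0 \<le> 2 * a" "0 \<le> 2 * A"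
    using range by simp_all
  obtain h where h: "h > 0" "half_period h = 1"
    using cases
  proof
    assume less: "a * b < ereal (pi\<^sup>2 / 2) \<and> ereal (pi\<^sup>2 / 2) < A * B"
    obtain h\<^sub>1 where h1: "h\<^sub>1 > 0" "1 \<le> half_period h\<^sub>1"
      by (rule slow_level[OF disjI1[OF refl] lim2[OF lim_a] lim_b nonneg2(1) range(3),
            unfolded prod2 zero_infty, OF ab_defined less[THEN conjunct1]])
    obtain h\<^sub>2 where h2: "h\<^sub>2 > 0" "half_period h\<^sub>2 \<le> 1"
      by (rule fast_level[OF disjI2[OF refl] lim2[OF lim_A] lim_B nonneg2(2) range(4),
            unfolded prod2, OF less[THEN conjunct2]])
    show thesis
      by (rule half_period_attains[OF h2 h1]) (rule that)
  next
    assume less: "A * B < ereal (pi\<^sup>2 / 2) \<and> ereal (pi\<^sup>2 / 2) < a * b"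
    obtain h\<^sub>1 where h1: "h\<^sub>1 > 0" "1 \<le> half_period h\<^sub>1"
      by (rule slow_level[OF disjI2[OF refl] lim2[OF lim_A] lim_B nonneg2(2) range(4),
            unfolded prod2 zero_infty, OF AB_defined less[THEN conjunct1]])
    obtain h\<^sub>2 where h2: "h\<^sub>2 > 0" "half_period h\<^sub>2 \<le> 1"
      by (rule fast_level[OF disjI1[OF refl] lim2[OF lim_a] lim_b nonneg2(1) range(3),
            unfolded prod2, OF less[THEN conjunct2]])
    show thesis
      by (rule half_period_attains[OF h2 h1]) (rule that)
  qed
  obtain x y where
    dx: "\<And>t. (x has_real_derivative - g (y t)) (at t)" and
    dy: "\<And>t. (y has_real_derivative 2 * f (x t)) (at t)" and
    x1: "\<And>t. x (t + 1) = - x t" and y1: "\<And>t. y (t + 1) = - y t" and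
    ne: "\<And>t. 0 < t \<Longrightarrow> t < 2 \<Longrightarrow> x t \<noteq> x 0"
    using symmetric_solution[OF h(1), unfolded h(2)] by (metis mult.right_neutral)
  have x2: "x (t + 2) = x t" and y2: "y (t + 2) = y t" for t
    using x1[of t] x1[of "t + 1"] y1[of t] y1[of "t + 1"] by (simp_all add: add.assoc)

  (* Minimality of the period of the pair follows from that of x alone. *)
  have "closed_orbit f g 2 (range (\<lambda>t. (x t, y t)))"
    unfolding closed_orbit_def planar_solution_def
    using dx dy ne by (intro exI[of _ x] exI[of _ y] conjI has_minimal_periodI) (auto simp: x2 y2)
  moreover have "SSPS f g x"
    unfolding SSPS_def
  proof (intro conjI allI)
    fix t
    have "((\<lambda>s. 2 * f (x (t - s))) has_integral - y (t - 1) - - y (t - 0)) {0..1}"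
    proof (rule fundamental_theorem_of_calculus)
      fix s
      have "((\<lambda>s. - y (t - s)) has_real_derivative 2 * f (x (t - s))) (at s)"
        by (auto intro!: derivative_eq_intros dy[THEN DERIV_chain2])
      then show "((\<lambda>s. - y (t - s)) has_vector_derivative 2 * f (x (t - s))) (at s within {0..1})"
        by (simp add: has_real_derivative_iff_has_vector_derivative has_vector_derivative_at_within)
    qed simp
    from has_integral_mult_right[OF this, of "1 / 2"]
    have "((\<lambda>s. f (x (t - s))) has_integral y t) {0..1}"
      using y1[of "t - 1"] by simp
    then show "(x has_real_derivative - g (integral {0..1} (\<lambda>s. f (x (t - s))))) (at t)"
      using dx[of t] by (simp add: integral_unique)
    show "x t + x (t - 1) = 0"
      using x1[of "t - 1"] by simp
  qed (use ne x2 in \<open>auto intro: has_minimal_periodI\<close>)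
  ultimately show ?thesis by blast
qed

end
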